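(* Let $n\in\mathbb{N}^*$ and let $f_0,f_1\in C^1(\mathbb{R}^n;\mathbb{R}^n)$ be globally Lipschitz, globally bounded vector fields with $f_0(0)=0$. Consider the control-affine system $\dot y(t)=f_0(y(t))+u(t)f_1(y(t))$ with state $y(t)\in\mathbb{R}^n$ and scalar control $u(t)\in\mathbb{R}$. Let $K_\infty\subset\mathbb{R}^n$ be the set of all its tangent vectors. Assume that $0\in\operatorname{int}K_\infty$. Then the system is $L^1$-STLNC (small-time locally null controllable).
   Context: For $T>0$, $u\in L^1((0,T);\mathbb{R})$ and $y_0\in\mathbb{R}^n$, $y(\cdot;u,y_0)\in C^0([0,T];\mathbb{R}^n)$ denotes the unique mild solution with initial data $y_0$, i.e. $y(t)=y_0+\int_0^t(f_0(y(s))+u(s)f_1(y(s)))\,ds$. Tangent vectors: $\xi\in\mathbb{R}^n$ is a tangent vector of order $k\in\mathbb{N}^*$ when there exists a family of controls $\{u_T\}$, defined for all sufficiently small $T>0$, with $u_T\in L^1((0,T);\mathbb{R})$, $\|u_T\|_{L^1(0,T)}\le T$, and $y(T;u_T,0)=T^k\xi+\mathcal{O}(T^{k+1})$ as $T\to0$. $K_k$ denotes the set of all tangent vectors of order $k$ and $K_\infty:=\bigcup_{k\ge1}K_k$. $L^1$-STLNC: for every $T>0$ there exists $\delta>0$ such that, for every $y_0\in B(0,\delta)$, there exists $u\in L^1((0,T);\mathbb{R})$ with $\|u\|_{L^1}\le T$ such that $y(T;u,y_0)=0$. *)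

theory Defs
  imports "HOL-Analysis.Analysis" "HOL-Library.Landau_Symbols"
begin

definition C1_field :: "('a::euclidean_space \<Rightarrow> 'a) \<Rightarrow> bool" where
  "C1_field f \<longleftrightarrow>
     (\<exists>f' :: 'a \<Rightarrow> 'a \<Rightarrow>\<^sub>L 'a.
        (\<forall>x. (f has_derivative blinfun_apply (f' x)) (at x)) \<and> continuous_on UNIV f')"

text \<open>
  Elements of $L^1((0,T);\mathbb{R})$ are represented by functions of type
  \<open>real \<Rightarrow> real\<close>; integrability and values matter only on the open interval.
\<close>

definition L1_control :: "real \<Rightarrow> (real \<Rightarrow> real) \<Rightarrow> bool" where
  "L1_control T u \<longleftrightarrow> u absolutely_integrable_on {0<..<T}"

definition L1_norm :: "real \<Rightarrow> (real \<Rightarrow> real) \<Rightarrow> real" where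
  "L1_norm T u = (LINT t:{0<..<T}|lebesgue. \<bar>u t\<bar>)"

text \<open>
  For continuous vector fields the solution relation below forces the integrand to be Lebesgue
  integrable (integrable control times continuous bounded factor), so the integral is never
  a default value. For globally Lipschitz bounded vector fields every control and initial
  state admit a solution, unique on \<open>{0..T}\<close>; statements about $y(\cdot;u,y_0)$
  are therefore phrased with this relation. Values of \<open>y\<close> outside \<open>{0..T}\<close> are irrelevant.
\<close>

definition mild_solution ::
  "('a::euclidean_space \<Rightarrow> 'a) \<Rightarrow> ('a \<Rightarrow> 'a) \<Rightarrow> real \<Rightarrow> (real \<Rightarrow> real) \<Rightarrow> 'a \<Rightarrow> (real \<Rightarrow> 'a) \<Rightarrow> bool"
where
  "mild_solution f0 f1 T u y0 y \<longleftrightarrow>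
     L1_control T u \<and> continuous_on {0..T} y \<and>
     (\<forall>t\<in>{0..T}. y t = y0 + (LINT s:{0..t}|lebesgue. f0 (y s) + u s *\<^sub>R f1 (y s)))"

text \<open>The trajectory \<open>y T\<close> of the family is the one driven by the control \<open>u T\<close> on \<open>{0..T}\<close>.\<close>

definition tangent_vector ::
  "('a::euclidean_space \<Rightarrow> 'a) \<Rightarrow> ('a \<Rightarrow> 'a) \<Rightarrow> nat \<Rightarrow> 'a \<Rightarrow> bool"
where
  "tangent_vector f0 f1 k \<xi> \<longleftrightarrow>
     (\<exists>(u :: real \<Rightarrow> real \<Rightarrow> real) (y :: real \<Rightarrow> real \<Rightarrow> 'a).
        (\<forall>\<^sub>F T in at_right 0.
           L1_control T (u T) \<and> L1_norm T (u T) \<le> T \<and> mild_solution f0 f1 T (u T) 0 (y T)) \<and>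
        (\<lambda>T. norm (y T T - T ^ k *\<^sub>R \<xi>)) \<in> O[at_right 0](\<lambda>T. T ^ (k + 1)))"

definition tangent_vectors ::
  "('a::euclidean_space \<Rightarrow> 'a) \<Rightarrow> ('a \<Rightarrow> 'a) \<Rightarrow> nat \<Rightarrow> 'a set"
where
  "tangent_vectors f0 f1 k = {\<xi>. tangent_vector f0 f1 k \<xi>}"

definition all_tangent_vectors ::
  "('a::euclidean_space \<Rightarrow> 'a) \<Rightarrow> ('a \<Rightarrow> 'a) \<Rightarrow> 'a set"
where
  "all_tangent_vectors f0 f1 = (\<Union>k\<in>{1..}. tangent_vectors f0 f1 k)"

definition L1_STLNC :: "('a::euclidean_space \<Rightarrow> 'a) \<Rightarrow> ('a \<Rightarrow> 'a) \<Rightarrow> bool" where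
  "L1_STLNC f0 f1 \<longleftrightarrow>
     (\<forall>T>0. \<exists>\<delta>>0. \<forall>y0\<in>ball 0 \<delta>.
        \<exists>u y. L1_control T u \<and> L1_norm T u \<le> T \<and> mild_solution f0 f1 T u y0 y \<and> y T = 0)"

end

theory Submission
  imports Defs
begin

text \<open>
  For short times the flow with control \<open>u\<close> differs from a translation by an error
  \<open>O(T \<bar>x\<bar>)\<close>, so a tangent vector \<open>\<xi>\<close> of order \<open>k\<close> allows one to move any small state \<open>x\<close>
  to \<open>x + T ^ k \<xi>\<close> up to \<open>O(T (T ^ k + \<bar>x\<bar>))\<close>. Small multiples of all
  signed basis vectors are tangent vectors, and one of them is used to cancel the largest component
  of \<open>x\<close>. Up to a relative error tending to 0 this multiplies the norm by at most
  \<open>sqrt (1 - 1 / n) < 1\<close>, in a time of order \<open>\<bar>x\<bar> powr (1 / N)\<close>. Iterating, the states decrease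
  geometrically, so the times are summable with small sum, and the concatenation of all the
  controls reaches 0 in finite time; the null control keeps the state there.
\<close>

section \<open>Concatenation of integrable functions\<close>

text \<open>Infinitely many pieces must be glued up to a time \<open>S\<close> that the nodes may
  never reach. Monotone convergence of the truncated norms yields an integrable majorant, and
  dominated convergence then handles the truncations of \<open>g\<close>.\<close>

lemma absolutely_integrable_Icc_limit:
  fixes g :: "real \<Rightarrow> 'a::euclidean_space"
  assumes int: "\<And>n. g absolutely_integrable_on {a..t n}"
    and "incseq t" and lim: "t \<longlonglongrightarrow> S"
    and bound: "\<And>n. integral {a..t n} (\<lambda>x. norm (g x)) \<le> B"
  shows "g absolutely_integrable_on {a..S}" "integral {a..S} (\<lambda>x. norm (g x)) \<le> B"
proof -
  have le_S: "t n \<le> S" for n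
    using incseq_le[OF \<open>incseq t\<close> lim] .
  have Int_eq: "{a..t k} \<inter> {a..S} = {a..t k}" for k
    using le_S[of k] by auto
  \<comment> \<open>If no \<open>t k\<close> reaches \<open>S\<close>, every truncation vanishes at
    \<open>S\<close>, so the pointwise limits are 0 there and not the values of \<open>g\<close>.
    The null set \<open>{S}\<close> is spiked away at the end.\<close>
  define h where "h x = (if \<exists>k. x \<le> t k then norm (g x) else 0)" for x
  define h' where "h' x = (if \<exists>k. x \<le> t k then g x else 0)" for x
  define f where "f k x = (if x \<in> {a..t k} then norm (g x) else 0)" for k x
  define f' where "f' k x = (if x \<in> {a..t k} then g x else 0)" for k x
  have reached: "\<exists>k. x \<le> t k" if "x \<le> S" "x \<noteq> S" for x
    using order_tendstoD(1)[OF lim, of x] that by (auto simp: eventually_sequentially intro: less_imp_le)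
  have ev: "\<forall>\<^sub>F k in sequentially. x \<le> t k \<longleftrightarrow> (\<exists>k. x \<le> t k)" for x
  proof (cases "\<exists>k. x \<le> t k")
    case True
    then obtain m where "x \<le> t m" by blast
    then have "x \<le> t k" if "k \<ge> m" for k
      using incseqD[OF \<open>incseq t\<close> that] by simp
    then show ?thesis
      using True eventually_sequentially by auto
  qed auto
  have f_int: "f k integrable_on {a..S}" for k
    unfolding f_def using int[of k] by (subst integrable_restrict_Int) (unfold Int_eq, simp add: absolutely_integrable_on_def)
  have f_abs: "f' k absolutely_integrable_on {a..S}" for k
  proof -
    have "f' k integrable_on {a..S}"
      unfolding f'_def using int[of k] by (subst integrable_restrict_Int) (unfold Int_eq, simp add: absolutely_integrable_on_def)
    moreover have "(\<lambda>x. norm (f' k x)) = f k" by (auto simp: f_def f'_def)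
    ultimately show ?thesis using f_int by (simp add: absolutely_integrable_on_def)
  qed
  have f_le: "integral {a..S} (f k) = integral {a..t k} (\<lambda>x. norm (g x))" for k
    unfolding f_def by (subst integral_restrict_Int) (unfold Int_eq, simp)
  have f_nonneg: "0 \<le> integral {a..S} (f k)" for k
    by (rule integral_nonneg[OF f_int]) (simp add: f_def)
  have conv: "h integrable_on {a..S} \<and> (\<lambda>k. integral {a..S} (f k)) \<longlonglongrightarrow> integral {a..S} h"
  proof (rule monotone_convergence_increasing)
    show "f k x \<le> f (Suc k) x" for k x
      using incseq_SucD[OF \<open>incseq t\<close>, of k] by (auto simp: f_def)
    show "(\<lambda>k. f k x) \<longlonglongrightarrow> h x" if "x \<in> {a..S}" for x
      by (rule tendsto_eventually, rule eventually_mono[OF ev[of x]]) (use that in \<open>auto simp: f_def h_def\<close>)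
    show "bounded (range (\<lambda>k. integral {a..S} (f k)))"
      unfolding bounded_iff using bound f_le f_nonneg by (intro exI[of _ B]) auto
  qed (rule f_int)
  have "h' absolutely_integrable_on {a..S}"
  proof (rule dominated_convergence_absolutely_integrable[OF f_abs])
    show "h integrable_on {a..S}" using conv by blast
    show "norm (h' x) \<le> h x" for x by (simp add: h_def h'_def)
    show "(\<lambda>k. f' k x) \<longlonglongrightarrow> h' x" if "x \<in> {a..S}" for x
      by (rule tendsto_eventually, rule eventually_mono[OF ev[of x]]) (use that in \<open>auto simp: f'_def h'_def\<close>)
  qed
  then show "g absolutely_integrable_on {a..S}"
    using absolutely_integrable_spike_eq[of "{S}" "{a..S}" g h'] reached by (force simp: h'_def)
  have "integral {a..S} (\<lambda>x. norm (g x)) = integral {a..S} h"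
    by (rule integral_spike[of "{S}"]) (use reached in \<open>auto simp: h_def\<close>)
  also have "\<dots> \<le> B"
    by (rule LIMSEQ_le_const2[of "\<lambda>k. integral {a..S} (f k)"]) (use conv bound f_le in auto)
  finally show "integral {a..S} (\<lambda>x. norm (g x)) \<le> B" .
qed

text \<open>Agreement at the right endpoint is not demanded, because in a concatenation the value at
  a node belongs to the following piece.\<close>

lemma has_integral_shifted_Icc:
  fixes g :: "real \<Rightarrow> 'a::euclidean_space"
  assumes "\<And>\<tau>. a \<le> \<tau> \<Longrightarrow> \<tau> < a + r \<Longrightarrow> G \<tau> = g (\<tau> - a)"
    and "(g has_integral I) {0..r}"
  shows "(G has_integral I) {a..a + r}"
proof (rule has_integral_spike_finite[of "{a + r}"])
  show "((\<lambda>\<tau>. g (\<tau> - a)) has_integral I) {a..a + r}"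
    using has_integral_shift_real_ivl[OF assms(2), of "- a"] by (simp add: add.commute)
qed (use assms(1) in auto)

text \<open>Applied both to controls and to right-hand sides. Pieces of length 0 are harmless, since
  their half-open interval in \<open>eq\<close> is empty.\<close>

lemma absolutely_integrable_concat:
  fixes g :: "nat \<Rightarrow> real \<Rightarrow> 'a::euclidean_space"
  assumes s: "\<And>n. 0 \<le> s n"
    and eq: "\<And>n \<tau>. sum s {..<n} \<le> \<tau> \<Longrightarrow> \<tau> < sum s {..<Suc n} \<Longrightarrow> G \<tau> = g n (\<tau> - sum s {..<n})"
    and int: "\<And>n. g n absolutely_integrable_on {0..s n}"
    and bound: "\<And>n. integral {0..s n} (\<lambda>x. norm (g n x)) \<le> c n"
  shows "G absolutely_integrable_on {0..sum s {..<n}}"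
    "(G has_integral (\<Sum>i<n. integral {0..s i} (g i))) {0..sum s {..<n}}"
    "integral {0..sum s {..<n}} (\<lambda>x. norm (G x)) \<le> sum c {..<n}"
proof -
  \<comment> \<open>The integrals of \<open>G\<close> and of its norm are carried through one
    induction, because together they give absolute integrability.\<close>
  have *: "(G has_integral (\<Sum>i<n. integral {0..s i} (g i))) {0..sum s {..<n}} \<and>
    ((\<lambda>x. norm (G x)) has_integral (\<Sum>i<n. integral {0..s i} (\<lambda>x. norm (g i x)))) {0..sum s {..<n}}"
  proof (induction n)
    case 0
    show ?case by (simp add: has_integral_refl(2))
  next
    case (Suc n)
    have t: "0 \<le> sum s {..<n}" "sum s {..<n} \<le> sum s {..<Suc n}"
      using s by (auto intro: sum_nonneg)
    have "(G has_integral integral {0..s n} (g n)) {sum s {..<n}..sum s {..<n} + s n}"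
      by (rule has_integral_shifted_Icc[where g = "g n"])
         (use int[of n] eq[of n] in \<open>auto simp: absolutely_integrable_on_def\<close>)
    moreover have "((\<lambda>x. norm (G x)) has_integral integral {0..s n} (\<lambda>x. norm (g n x)))
        {sum s {..<n}..sum s {..<n} + s n}"
      by (rule has_integral_shifted_Icc[where g = "\<lambda>x. norm (g n x)"])
         (use int[of n] eq[of n] in \<open>auto simp: absolutely_integrable_on_def\<close>)
    ultimately show ?case
      using Suc.IH t by (auto intro!: has_integral_combine[of 0 "sum s {..<n}"])
  qed
  show "G absolutely_integrable_on {0..sum s {..<n}}"
    using * by (auto simp: absolutely_integrable_on_def integrable_on_def)
  show "(G has_integral (\<Sum>i<n. integral {0..s i} (g i))) {0..sum s {..<n}}"
    using * by blast
  have "integral {0..sum s {..<n}} (\<lambda>x. norm (G x)) = (\<Sum>i<n. integral {0..s i} (\<lambda>x. norm (g i x)))"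
    using * by (simp add: integral_unique)
  then show "integral {0..sum s {..<n}} (\<lambda>x. norm (G x)) \<le> sum c {..<n}"
    using bound by (simp add: sum_mono)
qed

section \<open>Solutions of the control system\<close>

locale control_system =
  fixes f0 f1 :: "'a::euclidean_space \<Rightarrow> 'a" and L M :: real
  assumes lipschitz: "L-lipschitz_on UNIV f0" "L-lipschitz_on UNIV f1"
    and bounded_by: "\<And>x. norm (f0 x) \<le> M" "\<And>x. norm (f1 x) \<le> M"
    and equilibrium: "f0 0 = 0"
begin

definition rhs :: "(real \<Rightarrow> real) \<Rightarrow> (real \<Rightarrow> 'a) \<Rightarrow> real \<Rightarrow> 'a" where
  "rhs u y s = f0 (y s) + u s *\<^sub>R f1 (y s)"

text \<open>In contrast to \<^const>\<open>mild_solution\<close>, the bound on the $L^1$ norm of the control is built in.\<close>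

definition solves :: "real \<Rightarrow> (real \<Rightarrow> real) \<Rightarrow> 'a \<Rightarrow> (real \<Rightarrow> 'a) \<Rightarrow> bool" where
  "solves T u x y \<longleftrightarrow> u absolutely_integrable_on {0..T} \<and> integral {0..T} (\<lambda>s. \<bar>u s\<bar>) \<le> T \<and>
     continuous_on {0..T} y \<and> (\<forall>t\<in>{0..T}. (rhs u y has_integral y t - x) {0..t})"

lemma L_nonneg: "0 \<le> L"
  using lipschitz lipschitz_on_nonneg by blast

lemma M_nonneg: "0 \<le> M"
  using bounded_by(1)[of 0] norm_ge_zero order_trans by blast

lemma rhs_absolutely_integrable:
  assumes u: "u absolutely_integrable_on {0..T}" and y: "continuous_on {0..T} y"
  shows "rhs u y absolutely_integrable_on {0..T}"
proof -
  have cont: "continuous_on {0..T} (\<lambda>s. f0 (y s))" "continuous_on {0..T} (\<lambda>s. f1 (y s))"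
    using lipschitz[THEN lipschitz_on_continuous_on] y
    by (auto intro: continuous_on_compose2)
  have "(\<lambda>s. u s *\<^sub>R f1 (y s)) absolutely_integrable_on {0..T}"
  proof (rule absolutely_integrable_bounded_measurable_product[where h = "\<lambda>v r. r *\<^sub>R v"])
    show "bilinear (\<lambda>(v::'a) r. r *\<^sub>R v)"
      by (auto simp: bilinear_def linear_iff algebra_simps)
    show "(\<lambda>s. f1 (y s)) \<in> borel_measurable (lebesgue_on {0..T})"
      by (rule continuous_imp_measurable_on_sets_lebesgue[OF cont(2)]) auto
    show "bounded ((\<lambda>s. f1 (y s)) ` {0..T})"
      by (rule compact_imp_bounded[OF compact_continuous_image[OF cont(2)]]) simp
  qed (use u in auto)
  then show ?thesis
    unfolding rhs_def using absolutely_integrable_continuous_real[OF cont(1)]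
    by (rule set_integral_add(1)[rotated])
qed

text \<open>One \<open>M * T\<close> comes from the drift and one from the control budget. The bound
  is linear in \<open>T\<close>, so over consecutive pieces it adds up to a multiple of the total
  duration.\<close>

lemma rhs_norm_bound:
  assumes u: "u absolutely_integrable_on {0..T}" "integral {0..T} (\<lambda>s. \<bar>u s\<bar>) \<le> T"
    and y: "continuous_on {0..T} y" and "0 \<le> T"
  shows "integral {0..T} (\<lambda>s. norm (rhs u y s)) \<le> 2 * M * T"
proof -
  have "\<bar>u s\<bar> * norm (f1 (y s)) \<le> M * \<bar>u s\<bar>" for s
    using mult_left_mono[OF bounded_by(2)[of "y s"], of "\<bar>u s\<bar>"] by (simp add: mult.commute)
  then have "norm (rhs u y s) \<le> M + M * \<bar>u s\<bar>" for s
    unfolding rhs_def using norm_triangle_ineq[of "f0 (y s)" "u s *\<^sub>R f1 (y s)"] bounded_by(1)[of "y s"]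
    by (smt (verit) norm_scaleR)
  moreover have ui: "(\<lambda>s. \<bar>u s\<bar>) integrable_on {0..T}"
    using u(1) by (simp add: absolutely_integrable_on_def)
  ultimately have "integral {0..T} (\<lambda>s. norm (rhs u y s)) \<le> integral {0..T} (\<lambda>s. M + M * \<bar>u s\<bar>)"
    using rhs_absolutely_integrable[OF u(1) y]
    by (intro integral_le) (auto simp: absolutely_integrable_on_def intro!: integrable_add integrable_on_mult_right)
  also have "\<dots> = M * T + M * integral {0..T} (\<lambda>s. \<bar>u s\<bar>)"
    using ui \<open>0 \<le> T\<close> by (subst integral_add) (auto intro!: integrable_on_mult_right)
  also have "\<dots> \<le> 2 * M * T"
    using mult_left_mono[OF u(2) M_nonneg] by simp
  finally show ?thesis .
qed

text \<open>The factor 2 again counts the drift and the control, each contributing at most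
  \<open>L * T * D\<close>. This one estimate drives both the existence of solutions and their
  dependence on the initial state.\<close>

lemma rhs_integral_diff:
  assumes u: "u absolutely_integrable_on {0..T}" "integral {0..T} (\<lambda>s. \<bar>u s\<bar>) \<le> T"
    and y: "continuous_on {0..T} y" and z: "continuous_on {0..T} z"
    and D: "\<And>s. s \<in> {0..T} \<Longrightarrow> norm (y s - z s) \<le> D"
    and t: "t \<in> {0..T}"
  shows "norm (integral {0..t} (rhs u y) - integral {0..t} (rhs u z)) \<le> 2 * L * T * D"
proof -
  have D0: "0 \<le> D" using D[OF t] norm_ge_zero order_trans by blast
  have sub: "{0..t} \<subseteq> {0..T}" using t by auto
  have ri: "rhs u w integrable_on {0..t}" if "continuous_on {0..T} w" for w
    using integrable_on_subinterval[OF _ sub, of "rhs u w"] rhs_absolutely_integrable[OF u(1) that]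
    by (simp add: absolutely_integrable_on_def)
  have ui: "(\<lambda>s. \<bar>u s\<bar>) integrable_on {0..T}"
    using u(1) by (simp add: absolutely_integrable_on_def)
  then have ui': "(\<lambda>s. L * D * (1 + \<bar>u s\<bar>)) integrable_on {0..r}" if "r \<in> {0..T}" for r
    using that by (intro integrable_on_mult_right integrable_add integrable_on_subinterval[OF ui]) auto
  have le: "norm (rhs u y s - rhs u z s) \<le> L * D * (1 + \<bar>u s\<bar>)" if "s \<in> {0..T}" for s
  proof -
    have fd: "norm (f (y s) - f (z s)) \<le> L * D" if "L-lipschitz_on UNIV f" for f :: "'a \<Rightarrow> 'a"
      using lipschitz_onD[OF that, of "y s" "z s"] mult_left_mono[OF D[OF \<open>s \<in> {0..T}\<close>] L_nonneg]
      by (simp add: dist_norm)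
    have "rhs u y s - rhs u z s = (f0 (y s) - f0 (z s)) + u s *\<^sub>R (f1 (y s) - f1 (z s))"
      by (simp add: rhs_def algebra_simps)
    also have "norm \<dots> \<le> L * D + \<bar>u s\<bar> * (L * D)"
      using fd lipschitz by (intro norm_triangle_le add_mono) (auto intro: mult_left_mono)
    finally show ?thesis by (simp add: algebra_simps)
  qed
  have "norm (integral {0..t} (rhs u y) - integral {0..t} (rhs u z))
      = norm (integral {0..t} (\<lambda>s. rhs u y s - rhs u z s))"
    using ri y z by (subst Henstock_Kurzweil_Integration.integral_diff) auto
  also have "\<dots> \<le> integral {0..t} (\<lambda>s. L * D * (1 + \<bar>u s\<bar>))"
    using ri y z ui'[OF t] le sub
    by (intro Henstock_Kurzweil_Integration.integral_norm_bound_integral integrable_diff) auto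
  also have "\<dots> \<le> integral {0..T} (\<lambda>s. L * D * (1 + \<bar>u s\<bar>))"
    using ui'[OF t] ui'[of T] t D0 L_nonneg by (intro integral_subset_le) auto
  also have "\<dots> = L * D * (T + integral {0..T} (\<lambda>s. \<bar>u s\<bar>))"
    using has_integral_mult_right[OF has_integral_add[OF has_integral_const_real[of 1 0 T]
          integrable_integral[OF ui]], of "L * D"] t
    by (intro integral_unique) simp
  also have "\<dots> \<le> L * D * (T + T)"
    using u(2) D0 L_nonneg by (intro mult_left_mono) auto
  finally show ?thesis by (simp add: algebra_simps)
qed

lemma solvesD:
  assumes "solves T u x y"
  shows "u absolutely_integrable_on {0..T}" "integral {0..T} (\<lambda>s. \<bar>u s\<bar>) \<le> T"
    "continuous_on {0..T} y" "\<And>t. t \<in> {0..T} \<Longrightarrow> (rhs u y has_integral y t - x) {0..t}"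
  using assms by (auto simp: solves_def)

text \<open>Bridge between Lebesgue and gauge integrals: they agree for absolutely integrable
  integrands, and endpoints are null sets. Without integrability of \<open>u\<close> or continuity
  of \<open>y\<close> both sides fail.\<close>

lemma mild_solution_iff_solves:
  assumes "0 < T"
  shows "mild_solution f0 f1 T u x y \<and> L1_norm T u \<le> T \<longleftrightarrow> solves T u x y"
proof (cases "u absolutely_integrable_on {0..T} \<and> continuous_on {0..T} y")
  case False
  then show ?thesis
    using absolutely_integrable_on_open_interval[where f = u and a = 0 and b = T]
    by (auto simp: solves_def mild_solution_def L1_control_def)
next
  case True
  then have u: "u absolutely_integrable_on {0..T}" and y: "continuous_on {0..T} y" by auto
  have u': "u absolutely_integrable_on {0<..<T}"
    using absolutely_integrable_on_open_interval[where f = u and a = 0 and b = T] u by simp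
  have "L1_norm T u = integral {0<..<T} (\<lambda>s. \<bar>u s\<bar>)"
    unfolding L1_norm_def using absolutely_integrable_norm[OF u']
    by (intro set_lebesgue_integral_eq_integral(2)) (simp add: comp_def)
  then have norm: "L1_norm T u = integral {0..T} (\<lambda>s. \<bar>u s\<bar>)"
    by (simp add: integral_open_interval_real)
  have "y t = x + (LINT s:{0..t}|lebesgue. f0 (y s) + u s *\<^sub>R f1 (y s)) \<longleftrightarrow>
      (rhs u y has_integral y t - x) {0..t}" if "t \<in> {0..T}" for t
  proof -
    have "rhs u y absolutely_integrable_on {0..t}"
      by (rule absolutely_integrable_on_subinterval[OF rhs_absolutely_integrable[OF u y]]) (use that in auto)
    from set_lebesgue_integral_eq_integral[OF this] show ?thesis
      by (auto simp: rhs_def has_integral_iff algebra_simps)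
  qed
  then show ?thesis
    using u u' y norm by (auto simp: solves_def mild_solution_def L1_control_def)
qed

text \<open>Banach's fixed point theorem for the Picard map \<open>\<Phi>\<close>, which is a
  1/2-contraction in the supremum metric because \<open>2 * L * T \<le> 1/2\<close>.\<close>

lemma solution_exists:
  assumes u: "u absolutely_integrable_on {0..T}" "integral {0..T} (\<lambda>s. \<bar>u s\<bar>) \<le> T"
    and T: "0 \<le> T" "4 * L * T \<le> 1"
  obtains y where "solves T u x y"
proof -
  \<comment> \<open>Clamping time to \<open>{0..T}\<close> extends functions constantly to the whole
    line, so that the complete space of bounded continuous functions on the reals can be
    used.\<close>
  define c where "c t = max 0 (min t T)" for t
  have c: "c t \<in> {0..T}" for t using T by (auto simp: c_def)
  define \<Phi> where "\<Phi> g = Bcontfun (\<lambda>t. x + integral {0..c t} (rhs u (apply_bcontfun g)))" for g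
  have cont: "continuous_on {0..T} (\<lambda>t. x + integral {0..t} (rhs u (apply_bcontfun g)))" for g
    using rhs_absolutely_integrable[OF u(1), of "apply_bcontfun g"]
    by (intro continuous_intros indefinite_integral_continuous_1) (auto simp: absolutely_integrable_on_def)
  have \<Phi>: "apply_bcontfun (\<Phi> g) = (\<lambda>t. x + integral {0..c t} (rhs u (apply_bcontfun g)))" for g
  proof -
    have "continuous_on UNIV (\<lambda>t. x + integral {0..c t} (rhs u (apply_bcontfun g)))"
      by (rule continuous_on_compose2[OF cont])
         (use c in \<open>auto simp: c_def intro!: continuous_intros\<close>)
    moreover have "bounded (range (\<lambda>t. x + integral {0..c t} (rhs u (apply_bcontfun g))))"
      by (rule bounded_subset[OF compact_imp_bounded[OF compact_continuous_image[OF cont]]])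
         (use c in auto)
    ultimately show ?thesis
      unfolding \<Phi>_def by (intro Bcontfun_inverse) (simp add: bcontfun_def)
  qed
  have "\<exists>!g. \<Phi> g = g"
  proof (rule banach_fix_type[of "1/2"])
    show "\<forall>g h. dist (\<Phi> g) (\<Phi> h) \<le> 1/2 * dist g h"
    proof (intro allI dist_bound)
      fix g h t
      have "dist (apply_bcontfun (\<Phi> g) t) (apply_bcontfun (\<Phi> h) t) \<le> 2 * L * T * dist g h"
        unfolding \<Phi> dist_norm[where 'a = 'a] add_diff_cancel_left
        by (rule rhs_integral_diff[OF u]) (use c dist_bounded[of g _ h] in \<open>auto simp: dist_norm\<close>)
      also have "\<dots> \<le> 1/2 * dist g h"
        using T by (intro mult_right_mono) auto
      finally show "dist (apply_bcontfun (\<Phi> g) t) (apply_bcontfun (\<Phi> h) t) \<le> 1/2 * dist g h" .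
    qed
  qed auto
  then obtain g where g: "\<Phi> g = g" by blast
  have "(rhs u (apply_bcontfun g) has_integral apply_bcontfun g t - x) {0..t}" if t: "t \<in> {0..T}" for t
  proof -
    have "rhs u (apply_bcontfun g) integrable_on {0..t}"
      using absolutely_integrable_on_subinterval[OF rhs_absolutely_integrable[OF u(1), of "apply_bcontfun g"], of 0 t] t
      by (auto simp: absolutely_integrable_on_def)
    moreover have "apply_bcontfun g t = x + integral {0..t} (rhs u (apply_bcontfun g))"
      using fun_cong[OF \<Phi>[of g], of t] t by (simp add: g c_def)
    ultimately show ?thesis by (simp add: has_integral_iff)
  qed
  then have "solves T u x (apply_bcontfun g)"
    using u by (auto simp: solves_def)
  then show ?thesis by (rule that)
qed

text \<open>At a time \<open>m\<close> where the gap between the two solutions is largest, it is at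
  most \<open>norm (x - w)\<close> plus half of itself, hence at most
  \<open>2 * norm (x - w)\<close>. Inserting this into the integral estimate shows that the flow is
  a translation up to a factor of order \<open>T\<close>.\<close>

lemma solution_perturbation:
  assumes y: "solves T u x y" and z: "solves T u w z" and T: "0 \<le> T" "4 * L * T \<le> 1"
  shows "norm (y T - z T - (x - w)) \<le> 4 * L * T * norm (x - w)"
proof -
  have "continuous_on {0..T} (\<lambda>t. norm (y t - z t))"
    using solvesD(3)[OF y] solvesD(3)[OF z] by (intro continuous_intros)
  then obtain m where m: "m \<in> {0..T}" and max: "\<And>t. t \<in> {0..T} \<Longrightarrow> norm (y t - z t) \<le> norm (y m - z m)"
    using continuous_attains_sup[of "{0..T}" "\<lambda>t. norm (y t - z t)"] T by auto
  have le: "norm (y t - z t - (x - w)) \<le> 2 * L * T * norm (y m - z m)" if "t \<in> {0..T}" for t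
    using rhs_integral_diff[OF solvesD(1,2,3)[OF y] solvesD(3)[OF z] max that]
      integral_unique[OF solvesD(4)[OF y that]] integral_unique[OF solvesD(4)[OF z that]]
    by (simp add: algebra_simps)
  have "norm (y m - z m) \<le> norm (x - w) + norm (y m - z m - (x - w))"
    using norm_triangle_ineq[of "x - w" "y m - z m - (x - w)"] by simp
  also have "\<dots> \<le> norm (x - w) + 1/2 * norm (y m - z m)"
    using le[OF m] mult_right_mono[of "2 * L * T" "1/2" "norm (y m - z m)"] T by simp
  finally have "norm (y m - z m) \<le> 2 * norm (x - w)" by simp
  then have "2 * L * T * norm (y m - z m) \<le> 2 * L * T * (2 * norm (x - w))"
    using L_nonneg T by (intro mult_left_mono) auto
  then show ?thesis
    using le[of T] T by simp
qed

section \<open>Concatenation of trajectories\<close>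

text \<open>The control budget is inherited from \<open>solves\<close>. Budgets add up exactly as
  durations do, so the relation is closed under concatenation.\<close>

definition steers :: "real \<Rightarrow> 'a \<Rightarrow> 'a \<Rightarrow> bool" where
  "steers T x x' \<longleftrightarrow> 0 \<le> T \<and> (\<exists>u y. solves T u x y \<and> y T = x')"

lemma steers_zero_time: "steers 0 x x"
  unfolding steers_def solves_def
  by (auto intro!: exI[of _ "\<lambda>_. 0"] exI[of _ "\<lambda>_. x"] simp: has_integral_refl(2))

lemma steers_rest: "0 \<le> T \<Longrightarrow> steers T 0 0"
  unfolding steers_def solves_def rhs_def
  by (auto intro!: exI[of _ "\<lambda>_. 0"] simp: equilibrium)

text \<open>The glued control has norm integral at most \<open>S\<close> and the glued right-hand
  side at most \<open>2 * M * S\<close> on every \<open>{0..t n}\<close>. These bounds do not depend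
  on \<open>n\<close>, so integrability extends to \<open>{0..S}\<close>.\<close>

lemma steers_limit:
  assumes steers: "\<And>n. steers (s n) (x n) (x (Suc n))"
    and S: "s sums S" and l: "x \<longlonglongrightarrow> l"
  shows "steers S (x 0) l"
proof -
  have s: "0 \<le> s n" for n using steers[of n] by (simp add: steers_def)
  define t where "t n = sum s {..<n}" for n
  obtain U Y where sol: "\<And>n. solves (s n) (U n) (x n) (Y n)" and Y_end: "\<And>n. Y n (s n) = x (Suc n)"
    using steers unfolding steers_def by metis
  have t_lim: "t \<longlonglongrightarrow> S" using S by (simp add: sums_def t_def[abs_def])
  have "incseq t" unfolding t_def by (rule incseq_SucI) (simp add: s)
  note t_mono = incseqD[OF this]
  have t_le: "t n \<le> S" for n using incseq_le[OF \<open>incseq t\<close> t_lim] .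
  have t0: "0 \<le> t n" for n unfolding t_def using s by (intro sum_nonneg) auto
  have S0: "0 \<le> S" using t_le[of 0] by (simp add: t_def)
  \<comment> \<open>Index of the piece that contains \<open>\<tau>\<close>. The half-open convention
    makes it unique and skips pieces of length 0.\<close>
  define N where "N \<tau> = (LEAST n. \<tau> < t (Suc n))" for \<tau>
  have N_eq: "N \<tau> = n" if "t n \<le> \<tau>" "\<tau> < t (Suc n)" for n \<tau>
    unfolding N_def
  proof (rule Least_equality[where x = n])
    fix m assume "\<tau> < t (Suc m)"
    then have "t n < t (Suc m)" using that by simp
    then show "n \<le> m" using t_mono[of "Suc m" n] by (meson leD not_less_eq_eq)
  qed (rule that)
  have N: "t (N \<tau>) \<le> \<tau>" "\<tau> < t (Suc (N \<tau>))" if \<tau>: "0 \<le> \<tau>" "\<tau> < S" for \<tau>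
  proof -
    obtain m where "\<tau> < t m"
      using order_tendstoD(1)[OF t_lim \<tau>(2)] by (auto simp: eventually_sequentially)
    then have "\<tau> < t (Suc m)" using t_mono[of m "Suc m"] by simp
    then show "\<tau> < t (Suc (N \<tau>))" unfolding N_def by (rule LeastI)
    show "t (N \<tau>) \<le> \<tau>"
    proof (cases "N \<tau>")
      case 0
      then show ?thesis using \<tau> by (simp add: t_def)
    next
      case (Suc k)
      then have "\<not> \<tau> < t (Suc k)"
        using not_less_Least[of k "\<lambda>n. \<tau> < t (Suc n)"] by (simp add: N_def)
      then show ?thesis by (simp add: Suc)
    qed
  qed
  define u where "u \<tau> = U (N \<tau>) (\<tau> - t (N \<tau>))" for \<tau>
  \<comment> \<open>No piece contains \<open>S\<close>, so \<open>N S\<close> is unspecified. For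
    \<open>u\<close> a single point does not matter, whereas \<open>y\<close> must be given its
    limit \<open>l\<close> there.\<close>
  define y where "y \<tau> = (if \<tau> < S then Y (N \<tau>) (\<tau> - t (N \<tau>)) else l)" for \<tau>
  have u_eq: "u \<tau> = U n (\<tau> - t n)" if "t n \<le> \<tau>" "\<tau> < t (Suc n)" for n \<tau>
    using N_eq[OF that] by (simp add: u_def)
  have y_eq: "y \<tau> = Y n (\<tau> - t n)" if "t n \<le> \<tau>" "\<tau> < t (Suc n)" for n \<tau>
    using N_eq[OF that] t_le[of "Suc n"] that by (simp add: y_def)
  have F_eq: "rhs u y \<tau> = rhs (U n) (Y n) (\<tau> - t n)" if "t n \<le> \<tau>" "\<tau> < t (Suc n)" for n \<tau>
    using u_eq[OF that] y_eq[OF that] by (simp add: rhs_def)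
  have u_norm_n: "integral {0..s n} (\<lambda>\<tau>. norm (U n \<tau>)) \<le> s n" for n
    using solvesD(2)[OF sol[of n]] by simp
  note u_concat = absolutely_integrable_concat[of s u U s, OF s u_eq[unfolded t_def] solvesD(1)[OF sol]
      u_norm_n, folded t_def]
  have u_abs: "u absolutely_integrable_on {0..S}"
    by (rule absolutely_integrable_Icc_limit(1)[OF u_concat(1) \<open>incseq t\<close> t_lim
          order_trans[OF u_concat(3) t_le]])
  have u_norm: "integral {0..S} (\<lambda>\<tau>. \<bar>u \<tau>\<bar>) \<le> S"
    using absolutely_integrable_Icc_limit(2)[OF u_concat(1) \<open>incseq t\<close> t_lim
        order_trans[OF u_concat(3) t_le]] by simp
  have F_abs_n: "rhs (U n) (Y n) absolutely_integrable_on {0..s n}" for n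
    by (rule rhs_absolutely_integrable[OF solvesD(1,3)[OF sol]])
  have F_norm_n: "integral {0..s n} (\<lambda>\<tau>. norm (rhs (U n) (Y n) \<tau>)) \<le> 2 * M * s n" for n
    by (rule rhs_norm_bound[OF solvesD(1-3)[OF sol] s])
  note F_concat = absolutely_integrable_concat[of s "rhs u y" "\<lambda>n. rhs (U n) (Y n)" "\<lambda>n. 2 * M * s n",
      OF s F_eq[unfolded t_def] F_abs_n F_norm_n, folded t_def]
  have "integral {0..s n} (rhs (U n) (Y n)) = x (Suc n) - x n" for n
    using integral_unique[OF solvesD(4)[OF sol, of "s n"]] s Y_end by simp
  then have F_node: "(rhs u y has_integral x n - x 0) {0..t n}" for n
    using F_concat(2)[of n] by (simp add: sum_lessThan_telescope)
  have F_abs: "rhs u y absolutely_integrable_on {0..S}"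
  proof (rule absolutely_integrable_Icc_limit(1)[OF F_concat(1) \<open>incseq t\<close> t_lim])
    show "integral {0..t n} (\<lambda>\<tau>. norm (rhs u y \<tau>)) \<le> 2 * M * S" for n
      using F_concat(3)[of n] mult_left_mono[OF t_le[of n], of "2 * M"] M_nonneg
      by (simp add: t_def sum_distrib_left)
  qed
  then have F_int: "rhs u y integrable_on {0..S}" by (simp add: absolutely_integrable_on_def)
  \<comment> \<open>The integral equation at time \<open>S\<close> follows from those at the nodes \<open>t n\<close>, as \<open>J\<close> is continuous at \<open>S\<close>.\<close>
  define J where "J \<tau> = integral {0..\<tau>} (rhs u y)" for \<tau>
  have J: "(rhs u y has_integral J \<tau>) {0..\<tau>}" if "\<tau> \<in> {0..S}" for \<tau>
    unfolding J_def using that by (intro integrable_integral integrable_on_subinterval[OF F_int]) auto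
  have J_cont: "continuous_on {0..S} J"
    unfolding J_def by (rule indefinite_integral_continuous_1[OF F_int])
  have "(\<lambda>n. J (t n)) \<longlonglongrightarrow> J S"
    by (rule continuous_on_tendsto_compose[OF J_cont t_lim]) (use S0 t0 t_le in auto)
  moreover have "(\<lambda>n. J (t n)) \<longlonglongrightarrow> l - x 0"
    unfolding J_def integral_unique[OF F_node] by (intro tendsto_intros l)
  ultimately have J_S: "J S = l - x 0" by (rule LIMSEQ_unique)
  have y_J: "y \<tau> - x 0 = J \<tau>" if \<tau>: "\<tau> \<in> {0..S}" for \<tau>
  proof (cases "\<tau> < S")
    case True
    let ?n = "N \<tau>"
    have n: "t ?n \<le> \<tau>" "\<tau> < t (Suc ?n)" using N True \<tau> by auto
    have "(rhs (U ?n) (Y ?n) has_integral y \<tau> - x ?n) {0..\<tau> - t ?n}"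
      using solvesD(4)[OF sol, of "\<tau> - t ?n" ?n] n y_eq[OF n] by (simp add: t_def)
    then have "(rhs u y has_integral y \<tau> - x ?n) {t ?n..t ?n + (\<tau> - t ?n)}"
      by (rule has_integral_shifted_Icc[rotated]) (use F_eq[of ?n] n in auto)
    then have "(rhs u y has_integral y \<tau> - x ?n) {t ?n..\<tau>}" by simp
    from has_integral_combine[OF t0 n(1) F_node[of ?n] this]
    show ?thesis by (simp add: J_def integral_unique)
  next
    case False
    then show ?thesis using \<tau> J_S by (simp add: y_def)
  qed
  \<comment> \<open>Continuity is read off from the integral equation, so the pieces need not be
    matched at the nodes.\<close>
  have "continuous_on {0..S} y"
    by (rule continuous_on_eq[where f = "\<lambda>\<tau>. J \<tau> + x 0"])
       (use y_J J_cont in \<open>auto intro!: continuous_intros simp: algebra_simps\<close>)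
  then have "solves S u (x 0) y"
    using u_abs u_norm y_J J by (simp add: solves_def)
  then show ?thesis
    unfolding steers_def using S0 by (auto intro!: exI[of _ u] exI[of _ y] simp: y_def)
qed

text \<open>Padding with steps of zero duration turns two steps into an infinite
  concatenation.\<close>

lemma steers_trans:
  assumes "steers s x x'" "steers s' x' x''"
  shows "steers (s + s') x x''"
proof -
  define r where "r n = (if n = 0 then s else if n = 1 then s' else 0)" for n :: nat
  define p where "p n = (if n = 0 then x else if n = 1 then x' else x'')" for n :: nat
  have "steers (r n) (p n) (p (Suc n))" for n
    using assms steers_zero_time by (auto simp: r_def p_def)
  moreover have "r sums (s + s')"
    using sums_finite[of "{0,1}" r] by (auto simp: r_def)
  moreover have "p \<longlonglongrightarrow> x''"
    by (rule tendsto_eventually, rule eventually_sequentiallyI[of 2]) (auto simp: p_def)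
  ultimately show ?thesis
    using steers_limit[of r p] by (simp add: p_def)
qed

section \<open>Steering along tangent vectors\<close>

text \<open>The control of the tangent family is started at \<open>x\<close> instead of 0. The
  definition of the tangent vector contributes the error \<open>c * T ^ (k + 1)\<close>, and the
  change of initial state contributes \<open>4 * L * T * norm x\<close>.\<close>

lemma tangent_vector_step:
  assumes "tangent_vector f0 f1 k \<xi>"
  obtains C T0 where "0 \<le> C" "0 < T0"
    "\<And>T x. 0 < T \<Longrightarrow> T \<le> T0 \<Longrightarrow>
      \<exists>x'. steers T x x' \<and> norm (x' - (x + T ^ k *\<^sub>R \<xi>)) \<le> C * T * (T ^ k + norm x)"
proof -
  obtain u y where ev: "\<forall>\<^sub>F T in at_right 0.
      L1_control T (u T) \<and> L1_norm T (u T) \<le> T \<and> mild_solution f0 f1 T (u T) 0 (y T)"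
    and O: "(\<lambda>T. norm (y T T - T ^ k *\<^sub>R \<xi>)) \<in> O[at_right 0](\<lambda>T. T ^ (k + 1))"
    using assms unfolding tangent_vector_def by blast
  obtain c where c: "0 < c"
    and cO: "\<forall>\<^sub>F T in at_right 0. norm (norm (y T T - T ^ k *\<^sub>R \<xi>)) \<le> c * norm (T ^ (k + 1))"
    using landau_o.bigE[OF O] by blast
  obtain b where b: "0 < b"
    and small: "\<And>T. 0 < T \<Longrightarrow> T < b \<Longrightarrow> L1_norm T (u T) \<le> T \<and> mild_solution f0 f1 T (u T) 0 (y T) \<and>
      norm (norm (y T T - T ^ k *\<^sub>R \<xi>)) \<le> c * norm (T ^ (k + 1))"
    using eventually_conj[OF ev cO] unfolding eventually_at_right_field by auto
  \<comment> \<open>\<open>b / 2\<close> keeps \<open>T\<close> strictly below \<open>b\<close>;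
    \<open>1 / (4 * L + 1)\<close> ensures \<open>4 * L * T \<le> 1\<close> and makes sense for
    \<open>L = 0\<close> too.\<close>
  show ?thesis
  proof (rule that[of "c + 4 * L" "min (b / 2) (1 / (4 * L + 1))"])
    show "0 \<le> c + 4 * L" "0 < min (b / 2) (1 / (4 * L + 1))"
      using c b L_nonneg by auto
    fix T x assume T: "0 < T" "T \<le> min (b / 2) (1 / (4 * L + 1))"
    have "(4 * L + 1) * T \<le> 1"
      using T L_nonneg by (simp add: field_simps)
    then have LT: "4 * L * T \<le> 1" using T by (simp add: algebra_simps)
    have T_small: "L1_norm T (u T) \<le> T" "mild_solution f0 f1 T (u T) 0 (y T)"
      "norm (y T T - T ^ k *\<^sub>R \<xi>) \<le> c * T ^ (k + 1)"
      using small[of T] T b by auto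
    then have z: "solves T (u T) 0 (y T)"
      using mild_solution_iff_solves T by blast
    obtain w where w: "solves T (u T) x w"
      using solution_exists[OF solvesD(1,2)[OF z], of x] T LT by auto
    have "norm (w T - (x + T ^ k *\<^sub>R \<xi>)) \<le> norm (w T - y T T - x) + norm (y T T - T ^ k *\<^sub>R \<xi>)"
      using norm_triangle_ineq[of "w T - y T T - x" "y T T - T ^ k *\<^sub>R \<xi>"] by (simp add: algebra_simps)
    also have "\<dots> \<le> 4 * L * T * norm x + c * T ^ (k + 1)"
      using solution_perturbation[OF w z _ LT] T T_small(3) by simp
    also have "\<dots> \<le> (c + 4 * L) * T * (T ^ k + norm x)"
      using T c L_nonneg by (simp add: algebra_simps)
    finally show "\<exists>x'. steers T x x' \<and> norm (x' - (x + T ^ k *\<^sub>R \<xi>)) \<le> (c + 4 * L) * T * (T ^ k + norm x)"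
      unfolding steers_def using w T by auto
  qed
qed

text \<open>
  The single number \<open>N\<close> stands for the order of the tangent vector and for all constants, which
  makes the estimate uniform over finitely many directions \<open>v\<close>.
\<close>

lemma cancel_component:
  assumes tangent: "tangent_vector f0 f1 k (- (r *\<^sub>R v))"
    and k: "1 \<le> k" and r: "0 < r" and v: "norm v = 1"
  shows "\<forall>\<^sub>F N in sequentially. \<forall>x. norm x \<le> 1 / real N \<and> 0 \<le> x \<bullet> v \<longrightarrow>
    (\<exists>s x'. steers s x x' \<and> s \<le> N * norm x powr (1 / N) \<and>
      norm (x' - (x - (x \<bullet> v) *\<^sub>R v)) \<le> N * norm x powr (1 / N) * norm x)"
proof -
  obtain C T0 where C: "0 \<le> C" and T0: "0 < T0" and step: "\<And>T x. 0 < T \<Longrightarrow> T \<le> T0 \<Longrightarrow>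
      \<exists>x'. steers T x x' \<and> norm (x' - (x + T ^ k *\<^sub>R (- (r *\<^sub>R v)))) \<le> C * T * (T ^ k + norm x)"
    using tangent_vector_step[OF tangent] by blast
  \<comment> \<open>\<open>A\<close> is the constant in
    \<open>T \<le> A * norm x powr (1 / k)\<close>. The summands of \<open>B\<close> make
    \<open>N\<close> large enough for, in order: replacing the exponent \<open>1 / k\<close> by
    \<open>1 / N\<close> when \<open>norm x \<le> 1\<close>, the duration, the error, and
    \<open>T \<le> T0\<close>.\<close>
  define A where "A = (1 / r) powr (1 / k)"
  define B where "B = real k + A + C * A * (1 / r + 1) + 1 / (r * T0 ^ k)"
  have A: "0 \<le> A" by (simp add: A_def)
  have "\<forall>\<^sub>F N in sequentially. B \<le> real N"
    using filterlim_real_sequentially by (simp add: filterlim_at_top)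
  then show ?thesis
  proof (rule eventually_mono, intro allI impI)
    fix N :: nat and x :: 'a
    assume N: "B \<le> real N" and x: "norm x \<le> 1 / real N \<and> 0 \<le> x \<bullet> v"
    have nn: "0 \<le> C * A * (1 / r + 1)" "0 \<le> 1 / (r * T0 ^ k)"
      using C A r T0 by auto
    have N_ge: "k \<le> N" "A \<le> N" "C * A * (1 / r + 1) \<le> N" "1 / (r * T0 ^ k) \<le> N"
      using N A nn k unfolding B_def by linarith+
    have N0: "0 < real N" using N_ge(1) k by simp
    define a where "a = x \<bullet> v"
    have a: "0 \<le> a" "a \<le> norm x"
      using x Cauchy_Schwarz_ineq2[of x v] v by (auto simp: a_def)
    show "\<exists>s x'. steers s x x' \<and> s \<le> N * norm x powr (1 / N) \<and>
      norm (x' - (x - (x \<bullet> v) *\<^sub>R v)) \<le> N * norm x powr (1 / N) * norm x"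
    proof (cases "a = 0")
      \<comment> \<open>Nothing has to be cancelled, and the tangent step is available for positive
        durations only.\<close>
      case True
      then show ?thesis
        using steers_zero_time[of x] by (auto simp: a_def intro!: exI[of _ 0] exI[of _ x])
    next
      case False
      then have a_pos: "0 < a" using a by simp
      then have x_pos: "0 < norm x" using a by linarith
      have x_le_1: "norm x \<le> 1"
        using x N_ge(1) k order_trans[of "norm x" "1 / real N" 1] by simp
      \<comment> \<open>Solves \<open>T ^ k * r = a\<close>, so that the displacement along the
        tangent vector is exactly \<open>- a *\<^sub>R v\<close>.\<close>
      define T where "T = (a / r) powr (1 / k)"
      have T_pos: "0 < T" using a_pos r by (simp add: T_def)
      have T_pow: "T ^ k = a / r"
        using powr_powr[of "a / r" "1 / k" k] powr_realpow[OF T_pos, of k] a_pos r k by (simp add: T_def)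
      have "a / r \<le> 1 / N / r"
        using a x r by (intro divide_right_mono) auto
      also have "\<dots> \<le> T0 ^ k"
        using N_ge(4) N0 r T0 by (simp add: field_simps)
      finally have "T \<le> T0"
        using T_pow T_pos T0 k power_mono_iff[of T T0 k] by simp
      from step[OF T_pos this] obtain x' where x': "steers T x x'"
        "norm (x' - (x - a *\<^sub>R v)) \<le> C * T * (a / r + norm x)"
        using r by (auto simp: T_pow)
      have "T \<le> (norm x / r) powr (1 / k)"
        unfolding T_def using a r by (intro powr_mono2) (auto simp: divide_right_mono)
      also have "\<dots> = A * norm x powr (1 / k)"
        using r by (simp add: A_def powr_divide)
      also have "\<dots> \<le> A * norm x powr (1 / N)"
        using A x_pos x_le_1 N_ge(1) k by (intro mult_left_mono powr_mono') (auto simp: field_simps)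
      finally have T_le: "T \<le> A * norm x powr (1 / N)" .
      have "C * T * (a / r + norm x) \<le> C * (A * norm x powr (1 / N)) * (norm x / r + norm x)"
        using T_le C A a r T_pos by (intro mult_mono mult_left_mono add_mono divide_right_mono) auto
      also have "\<dots> = C * A * (1 / r + 1) * norm x powr (1 / N) * norm x"
        by (simp add: field_simps)
      also have "\<dots> \<le> N * norm x powr (1 / N) * norm x"
        using N_ge(3) by (intro mult_right_mono) auto
      finally have "norm (x' - (x - a *\<^sub>R v)) \<le> N * norm x powr (1 / N) * norm x"
        using x'(2) by simp
      moreover have "T \<le> N * norm x powr (1 / N)"
        using T_le mult_right_mono[OF N_ge(2), of "norm x powr (1 / N)"] by simp
      ultimately show ?thesis
        using x'(1) by (auto simp: a_def)
    qed
  qed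
qed

section \<open>Uniform contraction near the origin and its iteration\<close>

lemma contraction_step:
  assumes interior: "0 \<in> interior (all_tangent_vectors f0 f1)"
  obtains N :: nat and q \<rho> :: real where "1 \<le> N" "0 < q" "q < 1" "0 < \<rho>"
    "\<And>x. norm x \<le> \<rho> \<Longrightarrow> \<exists>s x'. steers s x x' \<and> s \<le> N * norm x powr (1 / N) \<and> norm x' \<le> q * norm x"
proof -
  obtain e where e: "0 < e" "ball 0 e \<subseteq> all_tangent_vectors f0 f1"
    using interior unfolding mem_interior by blast
  \<comment> \<open>A tangent vector is scaled by positive powers of \<open>T\<close> only, so both
    signs of every basis vector are needed to reduce coordinates of either sign.\<close>
  define V :: "'a set" where "V = Basis \<union> uminus ` Basis"
  define P where "P v N \<longleftrightarrow> (\<forall>x. norm x \<le> 1 / real N \<and> 0 \<le> x \<bullet> v \<longrightarrow>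
    (\<exists>s x'. steers s x x' \<and> s \<le> N * norm x powr (1 / N) \<and>
      norm (x' - (x - (x \<bullet> v) *\<^sub>R v)) \<le> N * norm x powr (1 / N) * norm x))" for v N
  have V1: "norm v = 1" if "v \<in> V" for v
    using that by (auto simp: V_def)
  have "\<forall>\<^sub>F N in sequentially. P v N" if "v \<in> V" for v
  proof -
    have "- ((e / 2) *\<^sub>R v) \<in> all_tangent_vectors f0 f1"
      using e V1[OF that] by (intro subsetD[OF e(2)]) simp
    then obtain k where "1 \<le> k" "tangent_vector f0 f1 k (- ((e / 2) *\<^sub>R v))"
      by (auto simp: all_tangent_vectors_def tangent_vectors_def)
    then show ?thesis
      unfolding P_def using cancel_component[of k "e / 2" v] e(1) V1[OF that] by simp
  qed
  \<comment> \<open>Since \<open>V\<close> is finite, one \<open>N\<close> serves all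
    directions.\<close>
  then have "\<forall>\<^sub>F N in sequentially. \<forall>v\<in>V. P v N"
    by (intro eventually_ball_finite) (auto simp: V_def)
  then obtain N where N: "1 \<le> N" and P: "\<And>v. v \<in> V \<Longrightarrow> P v N"
    using eventually_conj[OF _ eventually_ge_at_top[of 1]] eventually_happens' sequentially_bot by blast
  define d where "d = real DIM('a)"
  have d: "1 \<le> d" by (simp add: d_def Suc_leI)
  \<comment> \<open>The largest coordinate has square at least \<open>(norm x)\<^sup>2 / d\<close>;
    by Pythagoras, removing it leaves at most \<open>q * norm x\<close>.\<close>
  define q where "q = sqrt (1 - 1 / d)"
  have q: "0 \<le> q" "q < 1" using d by (auto simp: q_def)
  \<comment> \<open>The second term makes the relative error \<open>N * norm x powr (1 / N)\<close>
    at most \<open>(1 - q) / 2\<close>. The total factor is then \<open>(1 + q) / 2\<close>, which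
    is positive even in dimension one, where \<open>q = 0\<close>.\<close>
  define \<rho> where "\<rho> = min (1 / N) (((1 - q) / (2 * N)) ^ N)"
  show ?thesis
  proof (rule that[of N "(1 + q) / 2" \<rho>])
    show "1 \<le> N" "0 < (1 + q) / 2" "(1 + q) / 2 < 1" "0 < \<rho>"
      using N q by (auto simp: \<rho>_def)
    fix x :: 'a assume x: "norm x \<le> \<rho>"
    have "Max ((\<lambda>b. \<bar>x \<bullet> b\<bar>) ` Basis) \<in> (\<lambda>b. \<bar>x \<bullet> b\<bar>) ` Basis"
      by (rule Max_in) auto
    then obtain b where b: "b \<in> Basis" "Max ((\<lambda>b. \<bar>x \<bullet> b\<bar>) ` Basis) = \<bar>x \<bullet> b\<bar>"
      by (elim imageE)
    have max: "\<bar>x \<bullet> c\<bar> \<le> \<bar>x \<bullet> b\<bar>" if "c \<in> Basis" for c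
      unfolding b(2)[symmetric] by (rule Max_ge) (use that in auto)
    define v where "v = (if 0 \<le> x \<bullet> b then b else - b)"
    have v: "v \<in> V" "0 \<le> x \<bullet> v" and xv: "(x \<bullet> v)\<^sup>2 = (x \<bullet> b)\<^sup>2"
      using b by (auto simp: v_def V_def)
    have "(norm x)\<^sup>2 = (\<Sum>c\<in>Basis. (x \<bullet> c)\<^sup>2)"
      by (subst power2_norm_eq_inner, subst euclidean_inner) (simp add: power2_eq_square)
    also have "\<dots> \<le> (\<Sum>c\<in>(Basis::'a set). (x \<bullet> b)\<^sup>2)"
      using max by (intro sum_mono) (simp add: abs_le_square_iff)
    finally have "(norm x)\<^sup>2 / d \<le> (x \<bullet> v)\<^sup>2"
      using d by (simp add: d_def xv field_simps)
    moreover have "(norm (x - (x \<bullet> v) *\<^sub>R v))\<^sup>2 = (norm x)\<^sup>2 - (x \<bullet> v)\<^sup>2"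
      using V1[OF v(1)] unfolding power2_norm_eq_inner
      by (simp add: inner_diff_left inner_diff_right inner_commute power2_eq_square norm_eq_1)
    ultimately have "(norm (x - (x \<bullet> v) *\<^sub>R v))\<^sup>2 \<le> (q * norm x)\<^sup>2"
      using d by (simp add: q_def power_mult_distrib algebra_simps)
    then have proj: "norm (x - (x \<bullet> v) *\<^sub>R v) \<le> q * norm x"
      by (rule power2_le_imp_le) (simp add: q)
    have x_le: "norm x \<le> 1 / real N" "norm x \<le> ((1 - q) / (2 * N)) ^ N"
      using x by (auto simp: \<rho>_def)
    then obtain s x' where s: "steers s x x'" "s \<le> N * norm x powr (1 / N)"
      and x': "norm (x' - (x - (x \<bullet> v) *\<^sub>R v)) \<le> N * norm x powr (1 / N) * norm x"
      using P[OF v(1)] v(2) unfolding P_def by blast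
    have "norm x powr (1 / N) \<le> (((1 - q) / (2 * N)) ^ N) powr (1 / N)"
      using x_le by (intro powr_mono2) auto
    also have "\<dots> = (1 - q) / (2 * N)"
      using q N by (simp add: powr_realpow[symmetric] powr_powr)
    finally have "N * norm x powr (1 / N) \<le> (1 - q) / 2"
      using N by (simp add: field_simps)
    then have "N * norm x powr (1 / N) * norm x \<le> (1 - q) / 2 * norm x"
      by (rule mult_right_mono) simp
    then have "norm x' \<le> (1 + q) / 2 * norm x"
      using x' proj norm_triangle_ineq[of "x' - (x - (x \<bullet> v) *\<^sub>R v)" "x - (x \<bullet> v) *\<^sub>R v"]
      by (simp add: field_simps)
    then show "\<exists>s x'. steers s x x' \<and> s \<le> N * norm x powr (1 / N) \<and> norm x' \<le> (1 + q) / 2 * norm x"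
      using s by blast
  qed
qed

text \<open>The iterates satisfy \<open>norm (X n) \<le> q ^ n * norm x\<close>, so the durations
  are dominated by a geometric series of ratio \<open>p = q powr (1 / N)\<close>, whose sum tends to
  0 with \<open>norm x\<close>.\<close>

lemma steers_to_zero:
  assumes interior: "0 \<in> interior (all_tangent_vectors f0 f1)" and T: "0 < T"
  obtains \<delta> where "0 < \<delta>" "\<And>x. norm x \<le> \<delta> \<Longrightarrow> steers T x 0"
proof -
  obtain N :: nat and q \<rho> :: real where N: "1 \<le> N" and q: "0 < q" "q < 1" and \<rho>: "0 < \<rho>"
    and step: "\<And>x. norm x \<le> \<rho> \<Longrightarrow>
      \<exists>s x'. steers s x x' \<and> s \<le> N * norm x powr (1 / N) \<and> norm x' \<le> q * norm x"
    using contraction_step[OF interior] by blast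
  then obtain time to where next_step: "\<And>x. norm x \<le> \<rho> \<Longrightarrow>
      steers (time x) x (to x) \<and> time x \<le> N * norm x powr (1 / N) \<and> norm (to x) \<le> q * norm x"
    by metis
  define p where "p = q powr (1 / N)"
  have p: "0 < p" "p < 1"
    using q N powr_less_mono2[of "1 / N" q 1] by (auto simp: p_def)
  \<comment> \<open>Chosen so that \<open>N * norm x powr (1 / N) \<le> T * (1 - p)\<close>, which
    bounds the sum of the series by \<open>T\<close>.\<close>
  define \<delta> where "\<delta> = min \<rho> ((T * (1 - p) / N) ^ N)"
  show ?thesis
  proof (rule that[of \<delta>])
    show "0 < \<delta>" using \<rho> T p N by (simp add: \<delta>_def)
    fix x :: 'a assume x: "norm x \<le> \<delta>"
    define X where "X n = (to ^^ n) x" for n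
    have X_le: "norm (X n) \<le> q ^ n * norm x" and X_\<rho>: "norm (X n) \<le> \<rho>" for n
    proof (induction n)
      case 0
      show "norm (X 0) \<le> q ^ 0 * norm x" "norm (X 0) \<le> \<rho>"
        using x by (auto simp: X_def \<delta>_def)
    next
      case (Suc n)
      have *: "norm (X (Suc n)) \<le> q * norm (X n)"
        using next_step[OF Suc(2)] by (simp add: X_def)
      then show "norm (X (Suc n)) \<le> q ^ Suc n * norm x"
        using order_trans[OF * mult_left_mono[OF Suc(1)]] q by (simp add: mult.assoc)
      show "norm (X (Suc n)) \<le> \<rho>"
        using * Suc(2) q mult_right_mono[of q 1 "norm (X n)"] by simp
    qed
    define c where "c = N * norm x powr (1 / N)"
    have time: "time (X n) \<le> c * p ^ n" for n
    proof -
      have "time (X n) \<le> N * norm (X n) powr (1 / N)"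
        using next_step[OF X_\<rho>] by blast
      also have "\<dots> \<le> N * (q ^ n * norm x) powr (1 / N)"
        using X_le by (intro mult_left_mono powr_mono2) auto
      also have "(q ^ n * norm x) powr (1 / N) = p ^ n * norm x powr (1 / N)"
        using q by (simp add: p_def powr_mult powr_realpow[symmetric] powr_powr mult.commute)
      finally show ?thesis by (simp add: c_def algebra_simps)
    qed
    have steers_X: "steers (time (X n)) (X n) (X (Suc n))" for n
      using next_step[OF X_\<rho>] by (simp add: X_def)
    then have time0: "0 \<le> time (X n)" for n by (simp add: steers_def)
    have geom: "(\<lambda>n. c * p ^ n) sums (c * (1 / (1 - p)))"
      using p by (intro sums_mult geometric_sums) simp
    have summable: "summable (\<lambda>n. time (X n))"
      by (rule summable_comparison_test'[OF sums_summable[OF geom], of 0]) (use time time0 in auto)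
    have "(\<lambda>n. q ^ n * norm x) \<longlonglongrightarrow> 0"
      using q by (intro tendsto_mult_left_zero LIMSEQ_realpow_zero) auto
    then have X_lim: "X \<longlonglongrightarrow> 0"
      by (rule Lim_null_comparison[rotated]) (use X_le in auto)
    have "norm x powr (1 / N) \<le> ((T * (1 - p) / N) ^ N) powr (1 / N)"
      using x by (intro powr_mono2) (auto simp: \<delta>_def)
    also have "\<dots> = T * (1 - p) / N"
      using T p N by (simp add: powr_realpow[symmetric] powr_powr)
    finally have "c \<le> T * (1 - p)"
      using N by (simp add: c_def field_simps)
    then have "c * (1 / (1 - p)) \<le> T" using p by (simp add: field_simps)
    then have le: "(\<Sum>n. time (X n)) \<le> T"
      using suminf_le[OF time summable sums_summable[OF geom]] sums_unique[OF geom] by simp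
    have "steers (\<Sum>n. time (X n)) (X 0) 0"
      by (rule steers_limit[OF steers_X summable_sums[OF summable] X_lim])
    \<comment> \<open>The time left over until \<open>T\<close> is spent at the equilibrium.\<close>
    from steers_trans[OF this steers_rest, of "T - (\<Sum>n. time (X n))"] show "steers T x 0"
      using le by (simp add: X_def)
  qed
qed

end

section \<open>Transfer from \<open>steers\<close> to null controllability\<close>

theorem theorem4p9:
  fixes f0 f1 :: "real ^ 'n \<Rightarrow> real ^ 'n"
  assumes "C1_field f0" and "C1_field f1"
    and "\<exists>L. L-lipschitz_on UNIV f0" and "\<exists>L. L-lipschitz_on UNIV f1"
    and "bounded (range f0)" and "bounded (range f1)"
    and "f0 0 = 0"
    and "0 \<in> interior (all_tangent_vectors f0 f1)"
  shows "L1_STLNC f0 f1"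
proof -
  obtain L0 L1 where L: "L0-lipschitz_on UNIV f0" "L1-lipschitz_on UNIV f1"
    using assms(3,4) by blast
  obtain M0 M1 where M: "\<And>x. norm (f0 x) \<le> M0" "\<And>x. norm (f1 x) \<le> M1"
    using assms(5,6) by (auto simp: bounded_iff)
  \<comment> \<open>The maxima supply one Lipschitz constant and one bound valid for both
    fields.\<close>
  interpret control_system f0 f1 "max L0 L1" "max M0 M1"
  proof
    show "(max L0 L1)-lipschitz_on UNIV f0" "(max L0 L1)-lipschitz_on UNIV f1"
      using L by (auto intro: lipschitz_on_le)
  qed (use M assms(7) in \<open>auto simp: le_max_iff_disj\<close>)
  show ?thesis
    unfolding L1_STLNC_def
  proof (intro allI impI)
    fix T :: real assume T: "0 < T"
    obtain \<delta> where \<delta>: "0 < \<delta>" "\<And>x. norm x \<le> \<delta> \<Longrightarrow> steers T x 0"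
      using steers_to_zero[OF assms(8) T] by blast
    have "\<exists>u y. L1_control T u \<and> L1_norm T u \<le> T \<and> mild_solution f0 f1 T u y0 y \<and> y T = 0"
      if "y0 \<in> ball 0 \<delta>" for y0
    proof -
      obtain u y where "solves T u y0 y" "y T = 0"
        using \<delta>(2)[of y0] \<open>y0 \<in> ball 0 \<delta>\<close> by (auto simp: steers_def)
      then show ?thesis
        using mild_solution_iff_solves[OF T] mild_solution_def by blast
    qed
    then show "\<exists>\<delta>>0. \<forall>y0\<in>ball 0 \<delta>.
        \<exists>u y. L1_control T u \<and> L1_norm T u \<le> T \<and> mild_solution f0 f1 T u y0 y \<and> y T = 0"
      using \<delta>(1) by blast
  qed
qed

end
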